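(* Let $p\in\mathbb{N}$, $\beta>0$, $\alpha>(p-1)/2$, and let $\boldsymbol{\Sigma}$ be a $p\times p$ positive definite matrix. Let $\boldsymbol{\mathcal{X}}_1,\dots,\boldsymbol{\mathcal{X}}_n$ be i.i.d. random positive definite $p\times p$ matrices with the matrix gamma pdf $$f(\boldsymbol{x})=\frac{|\boldsymbol{\Sigma}|^{-\alpha}}{\beta^{p\alpha}\Gamma_p(\alpha)}|\boldsymbol{x}|^{\alpha-(p+1)/2}\exp\Big(-\frac1\beta\,\mathrm{tr}(\boldsymbol{\Sigma}^{-1}\boldsymbol{x})\Big),$$ $\overline{\boldsymbol{\mathcal{X}}}_n=\frac1n\sum_{\ell=1}^n\boldsymbol{\mathcal{X}}_\ell$ and $\boldsymbol{\mu}=\alpha\beta\boldsymbol{\Sigma}$. Then for positive definite $\boldsymbol{z}$, $$\Pr\{\overline{\boldsymbol{\mathcal{X}}}_n\succ\boldsymbol{z}\}\le\Big[\Big(\frac e{\alpha\beta}\Big)^{p\alpha}\Big(\frac{|\boldsymbol{z}|}{|\boldsymbol{\Sigma}|}\Big)^\alpha\exp\Big(-\frac1\beta\mathrm{tr}(\boldsymbol{\Sigma}^{-1}\boldsymbol{z})\Big)\Big]^n\quad\text{for }\boldsymbol{z}\succ\boldsymbol{\mu},$$ $$\Pr\{\overline{\boldsymbol{\mathcal{X}}}_n\prec\boldsymbol{z}\}\le\Big[\Big(\frac e{\alpha\beta}\Big)^{p\alpha}\Big(\frac{|\boldsymbol{z}|}{|\boldsymbol{\Sigma}|}\Big)^\alpha\exp\Big(-\frac1\beta\mathrm{tr}(\boldsymbol{\Sigma}^{-1}\boldsymbol{z})\Big)\Big]^n\quad\text{for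 }\boldsymbol{z}\prec\boldsymbol{\mu}.$$ In particular, $\Pr\{\overline{\boldsymbol{\mathcal{X}}}_n\succ\varrho\boldsymbol{\mu}\}\le[\varrho\exp(1-\varrho)]^{np\alpha}$ for $\varrho\ge1$, and $\Pr\{\overline{\boldsymbol{\mathcal{X}}}_n\prec\varrho\boldsymbol{\mu}\}\le[\varrho\exp(1-\varrho)]^{np\alpha}$ for $0\le\varrho\le1$.
   Context: $|\cdot|$ denotes the determinant, $\mathrm{tr}$ the trace, and $\Gamma_p$ the multivariate gamma function. For symmetric matrices, $\boldsymbol{x}\prec\boldsymbol{y}$ means $\boldsymbol{y}-\boldsymbol{x}$ is positive definite, and $\boldsymbol{x}\succ\boldsymbol{y}$ means $\boldsymbol{x}-\boldsymbol{y}$ is positive definite. *)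

theory Defs
  imports "HOL-Analysis.Analysis" "HOL-Probability.Probability"
begin

definition posdef :: "real^'n^'n \<Rightarrow> bool" where
  "posdef A \<longleftrightarrow> transpose A = A \<and> (\<forall>x. x \<noteq> 0 \<longrightarrow> x \<bullet> (A *v x) > 0)"

definition loewner_less :: "real^'n^'n \<Rightarrow> real^'n^'n \<Rightarrow> bool" (infix "\<prec>\<^sub>L" 50) where
  "x \<prec>\<^sub>L y \<longleftrightarrow> posdef (y - x)"

definition mgamma :: "nat \<Rightarrow> real \<Rightarrow> real" where
  "mgamma p a = pi powr (real p * (real p - 1) / 4) *
     (\<Prod>j\<in>{1..p}. Gamma (a - (real j - 1) / 2))"

text \<open>Coordinates of a symmetric matrix: one real number for each unordered pair {i,j}
  (i.e. the p(p+1)/2 entries on and above the diagonal).\<close>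
definition sym_index :: "'n set set" where
  "sym_index = {{i, j} | i j. True}"

definition sym_of :: "('n set \<Rightarrow> real) \<Rightarrow> real^'n^'n" where
  "sym_of u = (\<chi> i j. u {i, j})"

definition matrix_gamma_pdf :: "real \<Rightarrow> real \<Rightarrow> real^'n^'n \<Rightarrow> real^'n^'n \<Rightarrow> real" where
  "matrix_gamma_pdf \<alpha> \<beta> \<Sigma> x =
     (if posdef x then
        det \<Sigma> powr (-\<alpha>) / (\<beta> powr (real CARD('n) * \<alpha>) * mgamma CARD('n) \<alpha>)
        * det x powr (\<alpha> - (real CARD('n) + 1) / 2)
        * exp (- (1 / \<beta>) * trace (matrix_inv \<Sigma> ** x))
      else 0)"

text \<open>The matrix gamma distribution: the law on real^'n^'n of the symmetric matrix whose
  independent entries have joint Lebesgue density matrix_gamma_pdf.\<close>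
definition matrix_gamma :: "real \<Rightarrow> real \<Rightarrow> real^'n^'n \<Rightarrow> (real^'n^'n) measure" where
  "matrix_gamma \<alpha> \<beta> \<Sigma> =
     distr (density (PiM sym_index (\<lambda>_. lborel))
                    (\<lambda>u. ennreal (matrix_gamma_pdf \<alpha> \<beta> \<Sigma> (sym_of u))))
           borel sym_of"

end

theory Submission
  imports Defs
begin

text \<open>
  Chernoff's method with the linear functional \<open>X \<mapsto> tr (T X)\<close>. For positive definite \<open>Q\<close> the
  moment generating function at \<open>T = (\<Sigma>\<^sup>-\<^sup>1 - Q) / \<beta>\<close> is \<open>(det Q det \<Sigma>)\<^sup>-\<^sup>\<alpha>\<close>: tilting by \<open>T\<close> replaces
  \<open>\<Sigma>\<^sup>-\<^sup>1\<close> by \<open>Q\<close> in the density, and the substitution \<open>X \<mapsto> B X B\<^sup>T\<close> with \<open>B\<^sup>T P B = 1\<close>, whose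
  Jacobian on symmetric matrices is \<open>\<bar>det B\<bar>\<^sup>p\<^sup>+\<^sup>1\<close>, shows that the mass of the kernel with rate matrix \<open>P\<close>
  is \<open>(det P)\<^sup>-\<^sup>\<alpha>\<close> times a constant. This constant never has to be computed, because the law of \<open>X\<^sub>1\<close>
  has mass one. The optimal choice is \<open>Q = \<alpha>\<beta> z\<^sup>-\<^sup>1\<close>, so that \<open>T = \<alpha> (\<mu>\<^sup>-\<^sup>1 - z\<^sup>-\<^sup>1)\<close> is positive
  semidefinite for \<open>z \<succ> \<mu>\<close> and negative semidefinite for \<open>z \<prec> \<mu>\<close>; in both cases \<open>tr (T (X - z)) \<ge> 0\<close>
  on the event in question. For \<open>\<rho> = 0\<close> the bound follows by letting \<open>\<rho>\<close> tend to 0.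
\<close>

section \<open>Positive definite matrices\<close>

lemma symmetric_inner_matrix_vector:
  fixes A :: "real^'n^'n"
  assumes "transpose A = A"
  shows "x \<bullet> (A *v y) = y \<bullet> (A *v x)"
  by (metis assms dot_lmul_matrix inner_commute transpose_matrix_vector)

text \<open>Gram-Schmidt for the inner product \<open>x \<bullet> (P *v y)\<close>: the columns of
  \<open>B\<close> are a \<open>P\<close>-orthonormal basis, found one index at a time.\<close>

lemma posdef_congruent_identity:
  fixes P :: "real^'n^'n"
  assumes P: "posdef P"
  obtains B :: "real^'n^'n" where "transpose B ** P ** B = mat 1"
proof -
  have sym: "transpose P = P" and pos: "\<And>x. x \<noteq> 0 \<Longrightarrow> x \<bullet> (P *v x) > 0"
    using P by (auto simp: posdef_def)
  have "\<exists>b :: 'n \<Rightarrow> real^'n. \<forall>i\<in>S. \<forall>j\<in>S. b i \<bullet> (P *v b j) = of_bool (i = j)" for S :: "'n set"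
  proof (induction S rule: finite_induct[OF finite])
    case 1
    then show ?case by simp
  next
    case (2 k S)
    then obtain b where b: "\<And>i j. i \<in> S \<Longrightarrow> j \<in> S \<Longrightarrow> b i \<bullet> (P *v b j) = of_bool (i = j)"
      by blast
    \<comment> \<open>As \<open>k\<close> lies outside \<open>S\<close>, the vectors
      \<open>P *v b i\<close> span a proper subspace. A nonzero \<open>x\<close> orthogonal to it is
      \<open>P\<close>-orthogonal to every earlier \<open>b i\<close>, and only has to be
      normalised.\<close>
    have "dim ((\<lambda>i. P *v b i) ` S) \<le> card S"
      by (meson card_image_le dim_le_card' finite finite_imageI order_trans)
    also have "card S < DIM(real^'n)"
      using 2(2) by (auto intro!: psubset_card_mono)
    finally obtain x where x: "x \<noteq> 0" "\<And>y. y \<in> span ((\<lambda>i. P *v b i) ` S) \<Longrightarrow> orthogonal x y"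
      using orthogonal_to_subspace_exists by blast
    have x_orth: "x \<bullet> (P *v b i) = 0" if "i \<in> S" for i
      using x(2)[of "P *v b i"] that by (auto simp: orthogonal_def intro: span_base)
    define v where "v = (1 / sqrt (x \<bullet> (P *v x))) *\<^sub>R x"
    have "v \<bullet> (P *v v) = 1"
      using pos[OF x(1)] by (simp add: v_def matrix_vector_mult_scaleR)
    moreover have "v \<bullet> (P *v b i) = 0" if "i \<in> S" for i
      using x_orth[OF that] by (simp add: v_def)
    moreover from this have "b i \<bullet> (P *v v) = 0" if "i \<in> S" for i
      using symmetric_inner_matrix_vector[OF sym] that by metis
    ultimately show ?case
      using b 2(2) by (intro exI[of _ "b(k := v)"]) auto
  qed
  then obtain b :: "'n \<Rightarrow> real^'n" where b: "\<And>i j. b i \<bullet> (P *v b j) = of_bool (i = j)"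
    by (metis UNIV_I)
  define B :: "real^'n^'n" where "B = (\<chi> i j. b j $ i)"
  have "(transpose B ** P ** B) $ i $ j = b i \<bullet> (P *v b j)" for i j
    unfolding matrix_mul_assoc[symmetric]
    by (simp add: B_def matrix_matrix_mult_def transpose_def inner_vec_def matrix_vector_mult_def)
  then have "transpose B ** P ** B = mat 1"
    by (simp add: vec_eq_iff b mat_def)
  with that show thesis .
qed

lemma posdef_det_pos:
  fixes P :: "real^'n^'n"
  assumes "posdef P"
  shows "det P > 0"
proof -
  obtain B :: "real^'n^'n" where "transpose B ** P ** B = mat 1"
    using posdef_congruent_identity[OF assms] .
  then have "det (transpose B ** P ** B) = 1"
    by simp
  then have "(det B)\<^sup>2 * det P = 1"
    by (simp add: det_mul power2_eq_square mult_ac)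
  then have "0 < (det B)\<^sup>2 * det P"
    by simp
  then show ?thesis
    by (simp add: zero_less_mult_iff)
qed

text \<open>\<open>matrix_inv\<close> is a choice operator, so its defining property has to be
  extracted from invertibility, which the positive determinant provides.\<close>

lemma posdef_matrix_inv_mult:
  fixes P :: "real^'n^'n"
  assumes "posdef P"
  shows "P ** matrix_inv P = mat 1" "matrix_inv P ** P = mat 1"
proof -
  have "invertible P"
    using posdef_det_pos[OF assms] by (simp add: invertible_det_nz)
  then have "P ** matrix_inv P = mat 1 \<and> matrix_inv P ** P = mat 1"
    unfolding invertible_def matrix_inv_def by (rule someI_ex)
  then show "P ** matrix_inv P = mat 1" "matrix_inv P ** P = mat 1"
    by auto
qed

lemma transpose_matrix_inv_posdef:
  fixes P :: "real^'n^'n"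
  assumes "posdef P"
  shows "transpose (matrix_inv P) = matrix_inv P"
proof -
  have "transpose (matrix_inv P) ** P = mat 1"
    by (metis assms matrix_transpose_mul posdef_def posdef_matrix_inv_mult(1) transpose_mat)
  then show ?thesis
    by (metis assms matrix_mul_assoc matrix_mul_lid matrix_mul_rid posdef_matrix_inv_mult(1))
qed

lemma posdef_matrix_inv:
  fixes P :: "real^'n^'n"
  assumes "posdef P"
  shows "posdef (matrix_inv P)"
  unfolding posdef_def
proof (intro conjI allI impI)
  show "transpose (matrix_inv P) = matrix_inv P"
    by (rule transpose_matrix_inv_posdef[OF assms])
  fix x :: "real^'n" assume "x \<noteq> 0"
  define y where "y = matrix_inv P *v x"
  have x: "x = P *v y"
    by (simp add: y_def matrix_vector_mul_assoc posdef_matrix_inv_mult[OF assms])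
  then have "y \<noteq> 0"
    using \<open>x \<noteq> 0\<close> by auto
  then have "y \<bullet> (P *v y) > 0"
    using assms by (simp add: posdef_def)
  then show "x \<bullet> (matrix_inv P *v x) > 0"
    by (metis x y_def inner_commute)
qed

lemma det_matrix_inv_posdef:
  fixes P :: "real^'n^'n"
  assumes "posdef P"
  shows "det (matrix_inv P) = 1 / det P"
proof -
  have "det P * det (matrix_inv P) = 1"
    by (metis assms det_I det_mul posdef_matrix_inv_mult(1))
  with posdef_det_pos[OF assms] show ?thesis
    by (simp add: field_simps)
qed

section \<open>Inversion and the trace in the Loewner order\<close>

text \<open>With \<open>w\<close> and \<open>y\<close> the images of \<open>x\<close> under the two
  inverses, expand the form of \<open>A\<close> at \<open>w - y\<close>, which is nonnegative, and
  replace \<open>y \<bullet> (A *v y)\<close> by the larger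
  \<open>y \<bullet> (B *v y) = y \<bullet> x\<close>. What remains is
  \<open>y \<bullet> x \<le> w \<bullet> x\<close>.\<close>

lemma loewner_less_matrix_inv_antimono:
  fixes A B :: "real^'n^'n"
  assumes A: "posdef A" and B: "posdef B" and AB: "A \<prec>\<^sub>L B"
  shows "x \<bullet> ((matrix_inv A - matrix_inv B) *v x) \<ge> 0"
proof -
  define w y where "w = matrix_inv A *v x" and "y = matrix_inv B *v x"
  have Aw: "A *v w = x" and By: "B *v y = x"
    by (simp_all add: w_def y_def matrix_vector_mul_assoc posdef_matrix_inv_mult A B)
  have semi: "v \<bullet> (C *v v) \<ge> 0" if "posdef C" for C and v :: "real^'n"
    using that by (cases "v = 0") (auto simp: posdef_def less_imp_le)
  have "0 \<le> (w - y) \<bullet> (A *v (w - y))"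
    by (rule semi[OF A])
  also have "\<dots> = w \<bullet> x - 2 * (y \<bullet> x) + y \<bullet> (A *v y)"
    using symmetric_inner_matrix_vector[of A w y] A
    by (simp add: matrix_vector_mult_diff_distrib Aw inner_diff posdef_def)
  also have "y \<bullet> (A *v y) \<le> y \<bullet> (B *v y)"
    using semi[of "B - A" y] AB
    by (simp add: loewner_less_def matrix_vector_mult_diff_rdistrib inner_diff)
  finally have "y \<bullet> x \<le> w \<bullet> x"
    by (simp add: By)
  then show ?thesis
    by (simp add: matrix_vector_mult_diff_rdistrib inner_diff w_def y_def inner_commute)
qed

text \<open>Writing \<open>Y = B ** transpose B\<close> turns the trace into the sum of the
  quadratic form of \<open>T\<close> over the columns of \<open>B\<close>.\<close>

lemma trace_mult_posdef_nonneg: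
  fixes T Y :: "real^'n^'n"
  assumes T: "\<And>x. x \<bullet> (T *v x) \<ge> 0" and Y: "posdef Y"
  shows "trace (T ** Y) \<ge> 0"
proof -
  \<comment> \<open>Reducing the inverse of \<open>Y\<close>, rather than \<open>Y\<close> itself,
    to the identity yields the factorisation of \<open>Y\<close> directly.\<close>
  obtain B :: "real^'n^'n" where B: "transpose B ** matrix_inv Y ** B = mat 1"
    using posdef_congruent_identity[OF posdef_matrix_inv[OF Y]] .
  have Y_eq: "Y = B ** transpose B"
  proof -
    have "B ** (transpose B ** matrix_inv Y) = mat 1"
      using B matrix_left_right_inverse by blast
    then have "B ** transpose B ** matrix_inv Y ** Y = Y"
      by (simp add: matrix_mul_assoc)
    then show ?thesis
      by (simp add: matrix_mul_assoc[symmetric] posdef_matrix_inv_mult[OF Y])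
  qed
  have "trace (T ** Y) = trace (transpose B ** (T ** B))"
    by (simp add: Y_eq matrix_mul_assoc trace_mul_sym[of "T ** B"])
  also have "\<dots> = (\<Sum>i\<in>UNIV. column i B \<bullet> (T *v column i B))"
    by (simp add: trace_def matrix_matrix_mult_def transpose_def column_def inner_vec_def
        matrix_vector_mult_def)
  also have "\<dots> \<ge> 0"
    by (intro sum_nonneg T)
  finally show ?thesis .
qed

lemma posdef_scaleR:
  assumes "posdef A" "c > 0"
  shows "posdef (c *\<^sub>R A)"
  using assms
  by (auto simp: posdef_def transpose_scalar simp flip: scaleR_matrix_vector_assoc)

lemma posdef_add:
  assumes "posdef A" "posdef B"
  shows "posdef (A + B)"
  using assms
  by (auto simp: posdef_def transpose_def vec_eq_iff matrix_vector_mult_add_rdistrib inner_add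
      intro!: add_pos_pos)

section \<open>Measurability of positive definiteness\<close>

text \<open>The quadratic form attains a positive minimum on the compact unit sphere, and some
  \<open>1 / Suc k\<close> lies below it. This trades the strict inequality for non-strict ones and
  a countable union over \<open>k\<close>.\<close>

lemma posdef_bounded_below:
  fixes A :: "real^'n^'n"
  shows "posdef A \<longleftrightarrow>
    transpose A = A \<and> (\<exists>k::nat. \<forall>x. x \<bullet> (A *v x) \<ge> (x \<bullet> x) / real (Suc k))"
proof
  assume A: "posdef A"
  have "compact (sphere (0::real^'n) 1)" "sphere (0::real^'n) 1 \<noteq> {}"
    by auto
  moreover have "continuous_on (sphere 0 1) (\<lambda>x. x \<bullet> (A *v x))"
    by (intro continuous_intros)
  ultimately obtain x0 where x0: "x0 \<in> sphere 0 1"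
      "\<And>y. y \<in> sphere 0 1 \<Longrightarrow> x0 \<bullet> (A *v x0) \<le> y \<bullet> (A *v y)"
    by (metis continuous_attains_inf)
  have "x0 \<noteq> 0"
    using x0(1) by auto
  then have "x0 \<bullet> (A *v x0) > 0"
    using A by (simp add: posdef_def)
  then obtain k where k: "1 / real (Suc k) < x0 \<bullet> (A *v x0)"
    using nat_approx_posE by blast
  have "x \<bullet> (A *v x) \<ge> (x \<bullet> x) / real (Suc k)" for x
  proof (cases "x = 0")
    case False
    define y where "y = (1 / norm x) *\<^sub>R x"
    have "x0 \<bullet> (A *v x0) \<le> y \<bullet> (A *v y)"
      using False by (intro x0(2)) (simp add: y_def)
    then have "1 / real (Suc k) \<le> y \<bullet> (A *v y)"
      using k by linarith
    also have "\<dots> = x \<bullet> (A *v x) / (x \<bullet> x)"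
      by (simp add: y_def matrix_vector_mult_scaleR dot_square_norm power2_eq_square)
    finally show ?thesis
      using False by (simp add: pos_le_divide_eq)
  qed simp
  then show "transpose A = A \<and> (\<exists>k::nat. \<forall>x. x \<bullet> (A *v x) \<ge> (x \<bullet> x) / real (Suc k))"
    using A by (auto simp: posdef_def)
next
  assume "transpose A = A \<and> (\<exists>k::nat. \<forall>x. x \<bullet> (A *v x) \<ge> (x \<bullet> x) / real (Suc k))"
  then obtain k where "transpose A = A" and k: "\<And>x. x \<bullet> (A *v x) \<ge> (x \<bullet> x) / real (Suc k)"
    by blast
  moreover have "x \<bullet> (A *v x) > 0" if "x \<noteq> 0" for x
  proof -
    have "0 < (x \<bullet> x) / real (Suc k)"
      using that by (simp del: of_nat_Suc)
    then show ?thesis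
      using k[of x] by linarith
  qed
  ultimately show "posdef A"
    by (simp add: posdef_def)
qed

lemma continuous_on_det [continuous_intros]:
  fixes f :: "'a::topological_space \<Rightarrow> real^'n^'n"
  assumes "continuous_on S f"
  shows "continuous_on S (\<lambda>x. det (f x))"
  unfolding det_def using assms by (intro continuous_intros)

lemma continuous_on_trace [continuous_intros]:
  fixes f :: "'a::topological_space \<Rightarrow> real^'n^'n"
  assumes "continuous_on S f"
  shows "continuous_on S (\<lambda>x. trace (f x))"
  unfolding trace_def using assms by (intro continuous_intros)

lemma continuous_on_matrix_mult [continuous_intros]:
  fixes f :: "'a::topological_space \<Rightarrow> real^'n^'m" and g :: "'a \<Rightarrow> real^'k^'n"
  assumes "continuous_on S f" "continuous_on S g"
  shows "continuous_on S (\<lambda>x. f x ** g x)"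
  unfolding matrix_matrix_mult_def using assms by (intro continuous_intros)

text \<open>For each \<open>k\<close> the lower bound is an intersection of closed conditions on
  \<open>A\<close>, one for each \<open>x\<close>. The positive definite matrices therefore form a
  countable union of closed sets.\<close>

lemma posdef_borel [measurable]: "Measurable.pred borel (posdef :: real^'n^'n \<Rightarrow> bool)"
proof -
  let ?S = "\<lambda>k. {A :: real^'n^'n. \<forall>x. x \<bullet> (A *v x) \<ge> (x \<bullet> x) / real (Suc k)}"
  have cont: "continuous_on UNIV (\<lambda>A :: real^'n^'n. x \<bullet> (A *v x))" for x
    unfolding inner_vec_def matrix_vector_mult_def by (intro continuous_intros)
  have "closed (?S k)" for k
    by (intro closed_Collect_all closed_Collect_le continuous_intros cont)
  moreover have "closed {A :: real^'n^'n. transpose A = A}"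
    unfolding transpose_def by (intro closed_Collect_eq continuous_intros)
  ultimately have "{A :: real^'n^'n. transpose A = A} \<inter> (\<Union>k. ?S k) \<in> sets borel"
    by (intro sets.Int sets.countable_UN) (auto intro: borel_closed)
  also have "{A :: real^'n^'n. transpose A = A} \<inter> (\<Union>k. ?S k) = {A. posdef A}"
    by (auto simp: posdef_bounded_below)
  finally show ?thesis
    by (simp add: pred_def)
qed

section \<open>Triangular substitutions in product Lebesgue measure\<close>

text \<open>Split off coordinate \<open>k\<close> by Fubini. With the other coordinates fixed,
  \<open>h\<close> is a constant by \<open>h_indep\<close>, and the inner integral undergoes a
  one-dimensional affine substitution.\<close>

lemma nn_integral_PiM_lborel_affine_coordinate:
  fixes f :: "('i \<Rightarrow> real) \<Rightarrow> ennreal" and h :: "('i \<Rightarrow> real) \<Rightarrow> real"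
  assumes I: "finite I" "k \<in> I" and "c \<noteq> 0"
    and f [measurable]: "f \<in> borel_measurable (PiM I (\<lambda>_. lborel))"
    and h [measurable]: "h \<in> borel_measurable (PiM I (\<lambda>_. lborel))"
    and h_indep: "\<And>u y. h (u(k := y)) = h u"
  shows "(\<integral>\<^sup>+u. f u \<partial>PiM I (\<lambda>_. lborel)) =
         ennreal \<bar>c\<bar> * (\<integral>\<^sup>+u. f (u(k := c * u k + h u)) \<partial>PiM I (\<lambda>_. lborel))"
proof -
  interpret product_sigma_finite "\<lambda>_::'i. lborel :: real measure"
    by standard
  define J where "J = I - {k}"
  have J: "finite J" "k \<notin> J" "I = insert k J"
    using I by (auto simp: J_def)
  have upd [measurable]: "(\<lambda>u. u(k := c * u k + h u)) \<in> PiM I (\<lambda>_. lborel) \<rightarrow>\<^sub>M PiM I (\<lambda>_. lborel)"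
    by (rule measurable_fun_upd[where J = I]) (use I in auto)
  have g: "(\<lambda>u. ennreal \<bar>c\<bar> * f (u(k := c * u k + h u))) \<in> borel_measurable (PiM I (\<lambda>_. lborel))"
    by measurable
  have "(\<integral>\<^sup>+u. f u \<partial>PiM I (\<lambda>_. lborel)) =
        (\<integral>\<^sup>+x. (\<integral>\<^sup>+y. f (x(k := y)) \<partial>lborel) \<partial>PiM J (\<lambda>_. lborel))"
    using product_nn_integral_insert[OF J(1,2), of f] f J(3) by simp
  also have "\<dots> = (\<integral>\<^sup>+x. (\<integral>\<^sup>+y. ennreal \<bar>c\<bar> * f (x(k := c * y + h x)) \<partial>lborel) \<partial>PiM J (\<lambda>_. lborel))"
  proof (rule nn_integral_cong)
    fix x assume x: "x \<in> space (PiM J (\<lambda>_. lborel :: real measure))"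
    have "(\<lambda>y. x(k := y)) \<in> lborel \<rightarrow>\<^sub>M PiM I (\<lambda>_. lborel)"
      using measurable_component_update[OF x J(2)] J(3) by simp
    then have [measurable]: "(\<lambda>y. f (x(k := y))) \<in> borel_measurable borel"
      using f measurable_compose by fastforce
    show "(\<integral>\<^sup>+y. f (x(k := y)) \<partial>lborel) = (\<integral>\<^sup>+y. ennreal \<bar>c\<bar> * f (x(k := c * y + h x)) \<partial>lborel)"
      using nn_integral_real_affine[of "\<lambda>y. f (x(k := y))" c "h x"] \<open>c \<noteq> 0\<close>
      by (subst nn_integral_cmult) (simp_all add: add.commute)
  qed
  also have "\<dots> = (\<integral>\<^sup>+u. ennreal \<bar>c\<bar> * f (u(k := c * u k + h u)) \<partial>PiM I (\<lambda>_. lborel))"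
    using product_nn_integral_insert[OF J(1,2), of "\<lambda>u. ennreal \<bar>c\<bar> * f (u(k := c * u k + h u))"] g J(3)
    by (simp add: h_indep)
  also have "\<dots> = ennreal \<bar>c\<bar> * (\<integral>\<^sup>+u. f (u(k := c * u k + h u)) \<partial>PiM I (\<lambda>_. lborel))"
    by (rule nn_integral_cmult) measurable
  finally show ?thesis .
qed

text \<open>Induction on \<open>K\<close>, one coordinate at a time. No shift reads a coordinate in
  \<open>K\<close>, so performing the substitutions successively agrees with performing them
  simultaneously.\<close>

lemma nn_integral_PiM_lborel_affine_coordinates:
  fixes f :: "('i \<Rightarrow> real) \<Rightarrow> ennreal" and h :: "'i \<Rightarrow> ('i \<Rightarrow> real) \<Rightarrow> real"
  assumes I: "finite I" and K: "K \<subseteq> I"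
    and c: "\<And>k. k \<in> K \<Longrightarrow> c k \<noteq> 0"
    and f: "f \<in> borel_measurable (PiM I (\<lambda>_. lborel))"
    and h: "\<And>k. k \<in> K \<Longrightarrow> h k \<in> borel_measurable (PiM I (\<lambda>_. lborel))"
    and h_indep: "\<And>k l u y. k \<in> K \<Longrightarrow> l \<in> K \<Longrightarrow> h k (u(l := y)) = h k u"
  shows "(\<integral>\<^sup>+u. f u \<partial>PiM I (\<lambda>_. lborel)) =
         ennreal \<bar>\<Prod>k\<in>K. c k\<bar> *
         (\<integral>\<^sup>+u. f (\<lambda>k. if k \<in> K then c k * u k + h k u else u k) \<partial>PiM I (\<lambda>_. lborel))"
proof -
  have "finite K"
    using I K finite_subset by blast
  then show ?thesis
    using K c f h h_indep
  proof (induction K arbitrary: f rule: finite_induct)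
    case empty
    then show ?case by simp
  next
    case (insert k K)
    define T where "T = (\<lambda>u l. if l \<in> K then c l * u l + h l u else (u l :: real))"
    have T: "T \<in> PiM I (\<lambda>_. lborel) \<rightarrow>\<^sub>M PiM I (\<lambda>_. lborel)"
    proof (rule measurable_PiM_single')
      fix i assume i: "i \<in> I"
      show "(\<lambda>u. T u i) \<in> PiM I (\<lambda>_. lborel) \<rightarrow>\<^sub>M lborel"
      proof (cases "i \<in> K")
        case True
        then have [measurable]: "h i \<in> borel_measurable (PiM I (\<lambda>_. lborel))"
          using insert.prems by blast
        show ?thesis
          unfolding T_def using i by measurable
      next
        case False
        then show ?thesis
          using i by (simp add: T_def)
      qed
    next
      \<comment> \<open>Only coordinates in \<open>I\<close> are altered, so the value outside
        \<open>I\<close> remains \<open>undefined\<close>, as the product space demands.\<close>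
      show "T \<in> space (PiM I (\<lambda>_. lborel)) \<rightarrow> (\<Pi>\<^sub>E i\<in>I. space lborel)"
        using insert.prems(1) by (auto simp: T_def space_PiM PiE_def extensional_def)
    qed
    have "(\<integral>\<^sup>+u. f u \<partial>PiM I (\<lambda>_. lborel)) =
          ennreal \<bar>\<Prod>k\<in>K. c k\<bar> * (\<integral>\<^sup>+u. f (T u) \<partial>PiM I (\<lambda>_. lborel))"
      unfolding T_def by (rule insert.IH) (use insert.prems in auto)
    also have "(\<integral>\<^sup>+u. f (T u) \<partial>PiM I (\<lambda>_. lborel)) =
        ennreal \<bar>c k\<bar> * (\<integral>\<^sup>+u. f (T (u(k := c k * u k + h k u))) \<partial>PiM I (\<lambda>_. lborel))"
    proof (rule nn_integral_PiM_lborel_affine_coordinate)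
      show "(\<lambda>u. f (T u)) \<in> borel_measurable (PiM I (\<lambda>_. lborel))"
        by (rule measurable_compose[OF T insert.prems(3)])
      show "h k (u(k := y)) = h k u" for u y
        by (rule insert.prems(5)) auto
    qed (use insert.prems(1,2,4) I in auto)
    also have "(\<lambda>u. T (u(k := c k * u k + h k u))) =
               (\<lambda>u l. if l \<in> insert k K then c l * u l + h l u else u l)"
    proof -
      have "h l (u(k := y)) = h l u" if "l \<in> K" for l u y
        by (rule insert.prems(5)) (use that in auto)
      then show ?thesis
        using insert.hyps by (intro ext) (simp add: T_def)
    qed
    finally show ?case
      using insert.hyps by (simp add: abs_mult ennreal_mult mult.assoc mult.left_commute)
  qed
qed

text \<open>Permuting coordinates permutes the sides of a box and keeps the product of their
  lengths; boxes determine the product measure. Restriction to \<open>I\<close> keeps the permuted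
  function in the product space.\<close>

lemma nn_integral_PiM_lborel_reindex:
  fixes f :: "('i \<Rightarrow> real) \<Rightarrow> ennreal"
  assumes I: "finite I" and \<pi>: "bij_betw \<pi> I I"
    and f: "f \<in> borel_measurable (PiM I (\<lambda>_. lborel))"
  shows "(\<integral>\<^sup>+u. f u \<partial>PiM I (\<lambda>_. lborel)) =
         (\<integral>\<^sup>+u. f (\<lambda>i\<in>I. u (\<pi> i)) \<partial>PiM I (\<lambda>_. lborel))"
proof -
  interpret product_sigma_finite "\<lambda>_::'i. lborel :: real measure"
    by standard
  let ?P = "PiM I (\<lambda>_::'i. lborel :: real measure)"
  have \<pi>I: "\<pi> i \<in> I" if "i \<in> I" for i
    using \<pi> that by (auto simp: bij_betw_def)
  have [measurable]: "(\<lambda>u. \<lambda>i\<in>I. u (\<pi> i)) \<in> ?P \<rightarrow>\<^sub>M ?P"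
    by (rule measurable_restrict) (use \<pi>I in measurable)
  have "distr ?P ?P (\<lambda>u. \<lambda>i\<in>I. u (\<pi> i)) = ?P"
  proof (rule PiM_eqI[OF I])
    fix A :: "'i \<Rightarrow> real set" assume A: "\<And>i. i \<in> I \<Longrightarrow> A i \<in> sets lborel"
    let ?\<rho> = "the_inv_into I \<pi>"
    have \<rho>: "?\<rho> i \<in> I" "\<pi> (?\<rho> i) = i" if "i \<in> I" for i
      using \<pi> that by (auto simp: bij_betw_def the_inv_into_into f_the_inv_into_f)
    have \<rho>': "?\<rho> (\<pi> i) = i" if "i \<in> I" for i
      using \<pi> that by (auto simp: bij_betw_def the_inv_into_f_f)
    have "(\<lambda>u. \<lambda>i\<in>I. u (\<pi> i)) -` Pi\<^sub>E I A \<inter> space ?P = Pi\<^sub>E I (\<lambda>i. A (?\<rho> i))"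
    proof (rule set_eqI)
      fix u :: "'i \<Rightarrow> real"
      have "(\<forall>i\<in>I. u (\<pi> i) \<in> A i) \<longleftrightarrow> (\<forall>i\<in>I. u i \<in> A (?\<rho> i))"
        using \<pi>I \<rho> \<rho>' by metis
      then show "u \<in> (\<lambda>u. \<lambda>i\<in>I. u (\<pi> i)) -` Pi\<^sub>E I A \<inter> space ?P \<longleftrightarrow>
          u \<in> Pi\<^sub>E I (\<lambda>i. A (?\<rho> i))"
        by (auto simp: space_PiM PiE_iff)
    qed
    moreover have "Pi\<^sub>E I A \<in> sets ?P"
      using A I by (intro sets_PiM_I_finite) auto
    ultimately have "emeasure (distr ?P ?P (\<lambda>u. \<lambda>i\<in>I. u (\<pi> i))) (Pi\<^sub>E I A) =
        emeasure ?P (Pi\<^sub>E I (\<lambda>i. A (?\<rho> i)))"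
      by (simp add: emeasure_distr)
    also have "\<dots> = (\<Prod>i\<in>I. emeasure lborel (A (?\<rho> i)))"
      using A \<rho> I by (intro emeasure_PiM) auto
    also have "\<dots> = (\<Prod>i\<in>I. emeasure lborel (A i))"
      using \<rho>' by (subst prod.reindex_bij_betw[OF \<pi>, symmetric]) simp
    finally show "emeasure (distr ?P ?P (\<lambda>u. \<lambda>i\<in>I. u (\<pi> i))) (Pi\<^sub>E I A) =
        (\<Prod>i\<in>I. emeasure lborel (A i))" .
  qed simp
  then have "(\<integral>\<^sup>+u. f u \<partial>?P) = (\<integral>\<^sup>+u. f u \<partial>distr ?P ?P (\<lambda>u. \<lambda>i\<in>I. u (\<pi> i)))"
    by simp
  also have "\<dots> = (\<integral>\<^sup>+u. f (\<lambda>i\<in>I. u (\<pi> i)) \<partial>?P)"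
    using f by (intro nn_integral_distr) auto
  finally show ?thesis .
qed

section \<open>Congruence transformations of symmetric matrices\<close>

lemma sym_index_pair [simp]: "{i, j} \<in> sym_index"
  by (auto simp: sym_index_def)

lemma sym_index_singleton [simp]: "{i} \<in> sym_index"
  using sym_index_pair[of i i] by simp

lemma sym_of_nth [simp]: "sym_of u $ i $ j = u {i, j}"
  by (simp add: sym_of_def)

text \<open>Stated for a composite \<open>g\<close>, so that it applies to a substituted coordinate
  function by checking its pairs \<open>{i, j}\<close> alone.\<close>

lemma borel_measurable_sym_of:
  assumes "\<And>i j. (\<lambda>x. g x {i, j}) \<in> borel_measurable N"
  shows "(\<lambda>x. sym_of (g x)) \<in> borel_measurable N"
proof -
  have "(\<lambda>x. sym_of (g x) \<bullet> axis i (axis j 1)) \<in> borel_measurable N" for i j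
    using assms by (simp add: inner_axis)
  then show ?thesis
    by (subst borel_measurable_euclidean_space) (auto simp: Basis_vec_def)
qed

lemma sym_of_measurable [measurable]:
  "sym_of \<in> borel_measurable (PiM sym_index (\<lambda>_. lborel))"
  by (rule borel_measurable_sym_of[of "\<lambda>u. u"]) simp

lemma congruence_borel_measurable [measurable]:
  fixes A :: "real^'n^'m"
  shows "(\<lambda>X. A ** X ** transpose A) \<in> borel_measurable borel"
  by (intro borel_measurable_continuous_onI continuous_intros)

text \<open>The Jacobian of a diagonal congruence, which scales \<open>{i, j}\<close> by
  \<open>d i * d j\<close>. Each \<open>i\<close> lies in exactly \<open>CARD('n)\<close> of the
  index sets, and the singleton \<open>{i}\<close>, where \<open>d i\<close> must occur squared,
  supplies one more factor.\<close>

lemma prod_over_sym_index: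
  fixes d :: "'n::finite \<Rightarrow> real"
  shows "(\<Prod>s\<in>sym_index. (\<Prod>i\<in>s. d i) * (if card s = 1 then \<Prod>i\<in>s. d i else 1)) =
         (\<Prod>i\<in>UNIV. d i) ^ (CARD('n) + 1)"
proof -
  have "(\<Prod>s\<in>sym_index. \<Prod>i\<in>s. d i) = (\<Prod>s\<in>sym_index. \<Prod>i\<in>UNIV. if i \<in> s then d i else 1)"
    by (simp add: prod.If_cases)
  also have "\<dots> = (\<Prod>i\<in>UNIV. \<Prod>s\<in>sym_index. if i \<in> s then d i else 1)"
    by (rule prod.swap)
  also have "\<dots> = (\<Prod>i\<in>UNIV. d i ^ CARD('n))"
  proof (rule prod.cong[OF refl])
    fix i :: 'n
    have "(\<Prod>s\<in>sym_index. if i \<in> s then d i else 1) = d i ^ card (sym_index \<inter> {s. i \<in> s})"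
      by (simp add: prod.If_cases)
    also have "sym_index \<inter> {s. i \<in> s} = range (\<lambda>j. {i, j})"
      by (auto simp: sym_index_def)
    also have "card (range (\<lambda>j. {i, j})) = CARD('n)"
      by (rule card_image) (auto simp: inj_on_def doubleton_eq_iff)
    finally show "(\<Prod>s\<in>sym_index. if i \<in> s then d i else 1) = d i ^ CARD('n)" .
  qed
  finally have 1: "(\<Prod>s\<in>sym_index. \<Prod>i\<in>s. d i) = (\<Prod>i\<in>UNIV. d i) ^ CARD('n)"
    by (simp add: prod_power_distrib)
  have "(\<Prod>s\<in>sym_index. if card s = 1 then \<Prod>i\<in>s. d i else 1) =
        (\<Prod>s\<in>sym_index \<inter> {s. card s = 1}. \<Prod>i\<in>s. d i)"
    by (simp add: prod.If_cases)
  also have "sym_index \<inter> {s. card s = 1} = range (\<lambda>i::'n. {i})"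
    by (auto simp: card_1_singleton_iff)
  also have "(\<Prod>s\<in>range (\<lambda>i::'n. {i}). \<Prod>i\<in>s. d i) = (\<Prod>i\<in>UNIV. d i)"
    by (subst prod.reindex) auto
  finally show ?thesis
    using 1 by (simp add: prod.distrib mult.commute)
qed

section \<open>Elementary congruences: entries and determinants\<close>

lemma congruence_diagonal:
  fixes A X :: "real^'n^'n"
  assumes "\<And>i j. i \<noteq> j \<Longrightarrow> A $ i $ j = 0"
  shows "(A ** X ** transpose A) $ i $ j = A $ i $ i * A $ j $ j * X $ i $ j"
proof -
  have A: "A $ i $ k = (if k = i then A $ i $ i else 0)" for i k
    using assms by auto
  have row: "(A ** Y) $ i $ j = A $ i $ i * Y $ i $ j" for Y :: "real^'n^'n" and i j
    by (subst matrix_matrix_mult_def, simp, subst A) (simp add: if_distrib[of "\<lambda>x. x * _"] cong: if_cong)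
  \<comment> \<open>Transposing twice expresses the action on columns by the action on rows, so
    \<open>row\<close> is applied two times.\<close>
  have "A ** X ** transpose A = transpose (A ** transpose (A ** X))"
    by (simp add: matrix_transpose_mul)
  then show ?thesis
    by (simp add: transpose_def row)
qed

lemma congruence_transposition:
  fixes X :: "real^'n^'n" and m n :: 'n
  defines "A \<equiv> \<chi> i j. mat 1 $ i $ Transposition.transpose m n j"
  shows "(A ** X ** transpose A) $ i $ j =
         X $ Transposition.transpose m n i $ Transposition.transpose m n j"
proof -
  have A: "A $ i $ k = (if k = Transposition.transpose m n i then 1 else 0)" for i k
    by (auto simp: A_def mat_def)
  have row: "(A ** Y) $ i $ j = Y $ Transposition.transpose m n i $ j" for Y :: "real^'n^'n" and i j
    by (simp add: matrix_matrix_mult_def A if_distrib[of "\<lambda>x. x * _"] cong: if_cong)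
  have "A ** X ** transpose A = transpose (A ** transpose (A ** X))"
    by (simp add: matrix_transpose_mul)
  then show ?thesis
    by (simp add: transpose_def row)
qed

text \<open>A multiple of row \<open>n\<close> is added to row \<open>m\<close>, then likewise for
  columns. The entry at \<open>(m, m)\<close> is met by both operations and acquires the quadratic
  term.\<close>

lemma congruence_transvection:
  fixes X :: "real^'n^'n" and m n :: 'n and c :: real
  assumes "m \<noteq> n"
  defines "A \<equiv> \<chi> i j. if i = m \<and> j = n then c else of_bool (i = j)"
  shows "(A ** X ** transpose A) $ i $ j =
         X $ i $ j + (if i = m then c * X $ n $ j else 0) + (if j = m then c * X $ i $ n else 0)
         + (if i = m \<and> j = m then c\<^sup>2 * X $ n $ n else 0)"
proof -
  have A: "A $ i $ k = (if k = i then 1 else 0) + (if k = n then if i = m then c else 0 else 0)" for i k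
    using assms by (auto simp: A_def)
  have row: "(A ** Y) $ i $ j = Y $ i $ j + (if i = m then c * Y $ n $ j else 0)"
    for Y :: "real^'n^'n" and i j
    by (simp add: matrix_matrix_mult_def A distrib_right sum.distrib if_distrib[of "\<lambda>x. x * _"]
        cong: if_cong)
  have "A ** X ** transpose A = transpose (A ** transpose (A ** X))"
    by (simp add: matrix_transpose_mul)
  then show ?thesis
    by (simp add: transpose_def row algebra_simps power2_eq_square)
qed

lemma det_transposition_matrix:
  fixes m n :: "'n::finite"
  assumes "m \<noteq> n"
  shows "\<bar>det ((\<chi> i j. mat 1 $ i $ Transposition.transpose m n j) :: real^'n^'n)\<bar> = 1"
  using assms by (simp add: det_permute_columns permutes_swap_id sign_swap_id abs_mult)

lemma det_transvection:
  fixes m n :: "'n::finite" and c :: real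
  assumes "m \<noteq> n"
  shows "det ((\<chi> i j. if i = m \<and> j = n then c else of_bool (i = j)) :: real^'n^'n) = 1"
proof -
  have "((\<chi> i j. if i = m \<and> j = n then c else of_bool (i = j)) :: real^'n^'n) =
        (\<chi> k. if k = m then row m (mat 1) + c *s row n (mat 1) else row k (mat 1))"
    using assms by (auto simp: vec_eq_iff row_def mat_def)
  then show ?thesis
    using det_row_operation[OF assms, of "mat 1 :: real^'n^'n" c] by simp
qed

text \<open>The Jacobian factor is multiplicative in \<open>A\<close>, so elementary matrices suffice.\<close>

lemma nn_integral_sym_of_congruence:
  fixes A :: "real^'n^'n" and f :: "real^'n^'n \<Rightarrow> ennreal"
  assumes "det A \<noteq> 0" and "f \<in> borel_measurable borel"
  shows "(\<integral>\<^sup>+u. f (sym_of u) \<partial>PiM sym_index (\<lambda>_. lborel)) =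
         ennreal (\<bar>det A\<bar> ^ (CARD('n) + 1)) *
         (\<integral>\<^sup>+u. f (A ** sym_of u ** transpose A) \<partial>PiM sym_index (\<lambda>_. lborel))"
proof -
  let ?P = "PiM (sym_index :: 'n set set) (\<lambda>_. lborel :: real measure)"
  \<comment> \<open>The integrand is quantified inside the induction, because the product case uses
    the hypothesis for \<open>B\<close> with the integrand
    \<open>f (A ** X ** transpose A)\<close>.\<close>
  have "\<forall>f \<in> borel_measurable borel. det A \<noteq> 0 \<longrightarrow>
      (\<integral>\<^sup>+u. f (sym_of u) \<partial>?P) =
      ennreal (\<bar>det A\<bar> ^ (CARD('n) + 1)) * (\<integral>\<^sup>+u. f (A ** sym_of u ** transpose A) \<partial>?P)"
  proof (induction A rule: induct_matrix_elementary)
    case (1 A B)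
    show ?case
    proof (intro ballI impI)
      fix f :: "real^'n^'n \<Rightarrow> ennreal"
      assume f [measurable]: "f \<in> borel_measurable borel" and "det (A ** B) \<noteq> 0"
      then have det: "det A \<noteq> 0" "det B \<noteq> 0"
        by (simp_all add: det_mul)
      have fA: "(\<lambda>X. f (A ** X ** transpose A)) \<in> borel_measurable borel"
        by measurable
      have "(\<integral>\<^sup>+u. f (sym_of u) \<partial>?P) = ennreal (\<bar>det A\<bar> ^ (CARD('n) + 1)) *
          (ennreal (\<bar>det B\<bar> ^ (CARD('n) + 1)) *
           (\<integral>\<^sup>+u. f (A ** (B ** sym_of u ** transpose B) ** transpose A) \<partial>?P))"
        using 1(1) f det(1) 1(2)[rule_format, OF fA det(2)] by simp
      then show "(\<integral>\<^sup>+u. f (sym_of u) \<partial>?P) = ennreal (\<bar>det (A ** B)\<bar> ^ (CARD('n) + 1)) *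
          (\<integral>\<^sup>+u. f (A ** B ** sym_of u ** transpose (A ** B)) \<partial>?P)"
        by (simp add: det_mul abs_mult power_mult_distrib ennreal_mult matrix_transpose_mul
            matrix_mul_assoc mult_ac)
    qed
  next
    case (2 A i)
    then show ?case
      by (simp add: det_zero_row)
  next
    case (3 A)
    show ?case
    proof (intro ballI impI)
      fix f :: "real^'n^'n \<Rightarrow> ennreal"
      assume f [measurable]: "f \<in> borel_measurable borel" and det: "det A \<noteq> 0"
      \<comment> \<open>The product over \<open>{i}\<close> contains the diagonal entry only once;
        the second factor squares it, so that \<open>c_pair\<close> also holds for
        \<open>i = j\<close>.\<close>
      define c where "c s = (\<Prod>i\<in>s. A $ i $ i) * (if card s = 1 then \<Prod>i\<in>s. A $ i $ i else 1)"
        for s :: "'n set"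
      have det_eq: "det A = (\<Prod>i\<in>UNIV. A $ i $ i)"
        using 3 by (intro det_diagonal) auto
      then have "A $ i $ i \<noteq> 0" for i
        using det by simp
      then have c0: "c s \<noteq> 0" for s
        by (simp add: c_def)
      have prod_c: "(\<Prod>s\<in>sym_index. c s) = det A ^ (CARD('n) + 1)"
        unfolding c_def det_eq by (rule prod_over_sym_index)
      have c_pair: "c {i, j} = A $ i $ i * A $ j $ j" for i j
        by (cases "i = j") (auto simp: c_def)
      have sym: "sym_of (\<lambda>s. if s \<in> sym_index then c s * u s + 0 else u s) =
          A ** sym_of u ** transpose A" for u
        using 3 by (auto simp: vec_eq_iff congruence_diagonal c_pair)
      have "(\<integral>\<^sup>+u. f (sym_of u) \<partial>?P) = ennreal \<bar>\<Prod>s\<in>sym_index. c s\<bar> *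
          (\<integral>\<^sup>+u. f (sym_of (\<lambda>s. if s \<in> sym_index then c s * u s + 0 else u s)) \<partial>?P)"
        by (rule nn_integral_PiM_lborel_affine_coordinates) (auto simp: c0)
      then show "(\<integral>\<^sup>+u. f (sym_of u) \<partial>?P) = ennreal (\<bar>det A\<bar> ^ (CARD('n) + 1)) *
          (\<integral>\<^sup>+u. f (A ** sym_of u ** transpose A) \<partial>?P)"
        unfolding sym prod_c power_abs .
    qed
  next
    case (4 m n)
    let ?A = "(\<chi> i j. mat 1 $ i $ Transposition.transpose m n j) :: real^'n^'n"
    let ?\<tau> = "Transposition.transpose m n"
    \<comment> \<open>The transposition acts on unordered pairs by taking images, is its own inverse
      there, and hence merely permutes the coordinates.\<close>
    have "bij_betw ((`) ?\<tau>) sym_index sym_index"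
    proof (rule bij_betw_byWitness[where f' = "(`) ?\<tau>"])
      show "(`) ?\<tau> ` sym_index \<subseteq> sym_index"
        by (auto simp: sym_index_def)
      then show "(`) ?\<tau> ` sym_index \<subseteq> sym_index" .
    qed (auto simp: image_image)
    note reindex = nn_integral_PiM_lborel_reindex[OF finite this]
    have sym: "sym_of (\<lambda>s\<in>sym_index. u (?\<tau> ` s)) = ?A ** sym_of u ** transpose ?A" for u
      by (simp add: vec_eq_iff congruence_transposition)
    show ?case
      using reindex[of "\<lambda>u. f (sym_of u)" for f] sym det_transposition_matrix[OF 4] by simp
  next
    case (5 m n c)
    let ?A = "(\<chi> i j. if i = m \<and> j = n then c else of_bool (i = j)) :: real^'n^'n"
    \<comment> \<open>The transvection is split into two shears. \<open>K\<close> holds the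
      off-diagonal coordinates of row \<open>m\<close>, which \<open>T\<close> shifts;
      \<open>insert n (s - {m})\<close> turns \<open>{m, j}\<close> into \<open>{n, j}\<close>,
      including \<open>{n}\<close> for \<open>j = n\<close>. The diagonal coordinate
      \<open>{m}\<close> is treated separately.\<close>
    define K where "K = {{m, j} | j. j \<noteq> m}"
    define T where "T u s = (if s \<in> K then 1 * u s + c * u (insert n (s - {m})) else u s)"
      for u :: "'n set \<Rightarrow> real" and s
    have K_iff: "{i, j} \<in> K \<longleftrightarrow> (i = m) \<noteq> (j = m)" for i j
      by (auto simp: K_def doubleton_eq_iff)
    have insert_index: "insert n (s - {m}) \<in> sym_index" if "s \<in> K" for s
    proof -
      from that obtain j where "s - {m} = {j}"
        by (auto simp: K_def)
      then show ?thesis by simp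
    qed
    \<comment> \<open>The coordinate read by a shift does not contain \<open>m\<close>, whereas
      every member of \<open>K\<close> does; this is the independence required of the
      shifts.\<close>
    have insert_notin: "insert n (s - {m}) \<noteq> t" if "s \<in> K" "t \<in> K" for s t
      using 5 that by (auto simp: K_def)
    show ?case
    proof (intro ballI impI)
      fix f :: "real^'n^'n \<Rightarrow> ennreal"
      assume f [measurable]: "f \<in> borel_measurable borel"
      have "(\<integral>\<^sup>+u. f (sym_of u) \<partial>?P) = ennreal \<bar>\<Prod>s\<in>K. 1\<bar> * (\<integral>\<^sup>+u. f (sym_of (T u)) \<partial>?P)"
        unfolding T_def
        by (rule nn_integral_PiM_lborel_affine_coordinates)
           (use insert_index insert_notin in \<open>auto simp: K_def\<close>)
      \<comment> \<open>The update of \<open>{m}\<close> is performed before \<open>T\<close>, hence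
        from the original \<open>u {m, n}\<close>. By symmetry the two linear terms merge into
        \<open>2 * c * u {m, n}\<close>.\<close>
      also have "(\<integral>\<^sup>+u. f (sym_of (T u)) \<partial>?P) = ennreal \<bar>1\<bar> *
          (\<integral>\<^sup>+u. f (sym_of (T (u({m} := 1 * u {m} + (2 * c * u {m, n} + c\<^sup>2 * u {n}))))) \<partial>?P)"
      proof (rule nn_integral_PiM_lborel_affine_coordinate)
        have "(\<lambda>u. T u {i, j}) \<in> borel_measurable ?P" for i j
          using insert_index by (cases "{i, j} \<in> K") (simp_all add: T_def)
        then have [measurable]: "(\<lambda>u. sym_of (T u)) \<in> borel_measurable ?P"
          by (rule borel_measurable_sym_of)
        show "(\<lambda>u. f (sym_of (T u))) \<in> borel_measurable ?P"
          by measurable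
      qed (use 5 in \<open>auto simp: doubleton_eq_iff\<close>)
      also have "(\<lambda>u. sym_of (T (u({m} := 1 * u {m} + (2 * c * u {m, n} + c\<^sup>2 * u {n}))))) =
          (\<lambda>u. ?A ** sym_of u ** transpose ?A)"
      proof (intro ext)
        fix u :: "'n set \<Rightarrow> real"
        define v where "v = u({m} := 1 * u {m} + (2 * c * u {m, n} + c\<^sup>2 * u {n}))"
        have "T v {i, j} = (?A ** sym_of u ** transpose ?A) $ i $ j" for i j
        proof -
          consider "i = m" "j = m" | "i = m" "j \<noteq> m" | "i \<noteq> m" "j = m" | "i \<noteq> m" "j \<noteq> m"
            by blast
          then show ?thesis
          proof cases
            case 1
            then show ?thesis
              using K_iff[of m m] 5
              by (simp add: T_def v_def congruence_transvection[OF 5] insert_commute)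
          next
            case 2
            moreover have "insert n ({m, j} - {m}) = {n, j}"
              using 2 by auto
            ultimately show ?thesis
              using K_iff[of m j] 5
              by (simp add: T_def v_def congruence_transvection[OF 5] doubleton_eq_iff)
          next
            case 3
            moreover have "insert n ({i, m} - {m}) = {i, n}"
              using 3 by auto
            ultimately show ?thesis
              using K_iff[of i m] 5
              by (simp add: T_def v_def congruence_transvection[OF 5] doubleton_eq_iff)
          next
            case 4
            then show ?thesis
              using K_iff[of i j] 5
              by (simp add: T_def v_def congruence_transvection[OF 5] doubleton_eq_iff)
          qed
        qed
        then show "sym_of (T v) = ?A ** sym_of u ** transpose ?A"
          by (simp add: vec_eq_iff)
      qed
      finally show "(\<integral>\<^sup>+u. f (sym_of u) \<partial>?P) = ennreal (\<bar>det ?A\<bar> ^ (CARD('n) + 1)) *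
          (\<integral>\<^sup>+u. f (?A ** sym_of u ** transpose ?A) \<partial>?P)"
        by (simp add: det_transvection[OF 5])
    qed
  qed
  then show ?thesis
    using assms by blast
qed

section \<open>The matrix gamma distribution\<close>

text \<open>The form of the congruent matrix at \<open>x\<close> is the form of \<open>X\<close> at
  \<open>transpose B *v x\<close>, nonzero for nonzero \<open>x\<close>. The converse is the same
  statement for the inverse of \<open>B\<close>.\<close>

lemma posdef_congruence:
  fixes B X :: "real^'n^'n"
  assumes "det B \<noteq> 0"
  shows "posdef (B ** X ** transpose B) \<longleftrightarrow> posdef X"
proof -
  have *: "posdef (B ** X ** transpose B)" if X: "posdef X" and B: "det B \<noteq> 0" for B X :: "real^'n^'n"
    unfolding posdef_def
  proof (intro conjI allI impI)
    show "transpose (B ** X ** transpose B) = B ** X ** transpose B"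
      using X by (simp add: posdef_def matrix_transpose_mul matrix_mul_assoc)
    fix x :: "real^'n" assume "x \<noteq> 0"
    have "inj ((*v) (transpose B))"
      using B by (intro inj_matrix_vector_mult) (simp add: invertible_det_nz)
    then have "transpose B *v x \<noteq> 0"
      using \<open>x \<noteq> 0\<close> by (metis injD matrix_vector_mult_0_right)
    then have "(transpose B *v x) \<bullet> (X *v (transpose B *v x)) > 0"
      using X unfolding posdef_def by blast
    also have "(transpose B *v x) \<bullet> (X *v (transpose B *v x)) = x \<bullet> (B *v (X *v (transpose B *v x)))"
      by (simp add: dot_lmul_matrix)
    finally show "x \<bullet> ((B ** X ** transpose B) *v x) > 0"
      by (simp only: matrix_vector_mul_assoc matrix_mul_assoc)
  qed
  obtain C where C: "C ** B = mat 1" "B ** C = mat 1"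
    using assms by (metis invertible_def invertible_det_nz)
  have "det C * det B = 1"
    using C(1) by (metis det_I det_mul)
  then have "det C \<noteq> 0"
    by auto
  moreover have "C ** (B ** X ** transpose B) ** transpose C = X"
  proof -
    have "C ** (B ** X ** transpose B) ** transpose C = (C ** B) ** X ** transpose (C ** B)"
      by (simp only: matrix_transpose_mul matrix_mul_assoc)
    then show ?thesis
      by (simp add: C)
  qed
  ultimately show ?thesis
    using * assms by metis
qed

text \<open>The density without its constant, with a free rate matrix \<open>P\<close> in place of
  the inverse of \<Sigma>, so that exponential tilting stays within the family.\<close>

definition matrix_gamma_kernel :: "real \<Rightarrow> real \<Rightarrow> real^'n^'n \<Rightarrow> real^'n^'n \<Rightarrow> real" where
  "matrix_gamma_kernel \<alpha> \<beta> P X =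
     (if posdef X then det X powr (\<alpha> - (real CARD('n) + 1) / 2) * exp (- (1 / \<beta>) * trace (P ** X))
      else 0)"

lemma matrix_gamma_kernel_nonneg: "matrix_gamma_kernel \<alpha> \<beta> P X \<ge> 0"
  by (simp add: matrix_gamma_kernel_def)

lemma matrix_gamma_kernel_measurable [measurable]:
  "matrix_gamma_kernel \<alpha> \<beta> P \<in> borel_measurable borel"
proof -
  have [measurable]: "(\<lambda>X :: real^'a^'a. det X) \<in> borel_measurable borel"
      "(\<lambda>X. trace (P ** X)) \<in> borel_measurable borel"
    by (intro borel_measurable_continuous_onI continuous_intros)+
  show ?thesis
    unfolding matrix_gamma_kernel_def by measurable
qed

text \<open>Substitute \<open>B ** X ** transpose B\<close> with \<open>B\<close> reducing
  \<open>P\<close> to the identity. The integral on the right is left unevaluated; only the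
  dependence on \<open>P\<close> matters.\<close>

lemma nn_integral_matrix_gamma_kernel:
  fixes P :: "real^'n^'n"
  assumes P: "posdef P"
  shows "(\<integral>\<^sup>+u. ennreal (matrix_gamma_kernel \<alpha> \<beta> P (sym_of u)) \<partial>PiM sym_index (\<lambda>_. lborel)) =
    ennreal (det P powr - \<alpha>) *
    (\<integral>\<^sup>+u. ennreal (matrix_gamma_kernel \<alpha> \<beta> (mat 1 :: real^'n^'n) (sym_of u)) \<partial>PiM sym_index (\<lambda>_. lborel))"
proof -
  obtain B :: "real^'n^'n" where B: "transpose B ** P ** B = mat 1"
    using posdef_congruent_identity[OF P] .
  then have "det (transpose B ** P ** B) = 1"
    by simp
  then have detBP: "(det B)\<^sup>2 * det P = 1"
    by (simp add: det_mul power2_eq_square mult_ac)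
  then have B0: "det B \<noteq> 0"
    by auto
  define e where "e = \<alpha> - (real CARD('n) + 1) / 2"
  have kernel: "matrix_gamma_kernel \<alpha> \<beta> P (B ** X ** transpose B) =
      \<bar>det B\<bar> powr (2 * e) * matrix_gamma_kernel \<alpha> \<beta> (mat 1) X" for X
  proof (cases "posdef X")
    case True
    have "det (B ** X ** transpose B) powr e = (\<bar>det B\<bar> powr 2 * det X) powr e"
      using B0 by (simp add: det_mul power2_eq_square mult_ac)
    also have "\<dots> = \<bar>det B\<bar> powr (2 * e) * det X powr e"
      using posdef_det_pos[OF True] by (simp add: powr_mult powr_powr del: powr_numeral)
    finally have 1: "det (B ** X ** transpose B) powr e = \<bar>det B\<bar> powr (2 * e) * det X powr e" .
    have "trace (P ** (B ** X ** transpose B)) = trace ((P ** B ** X) ** transpose B)"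
      by (simp only: matrix_mul_assoc)
    also have "\<dots> = trace (transpose B ** (P ** B ** X))"
      by (rule trace_mul_sym)
    also have "transpose B ** (P ** B ** X) = transpose B ** P ** B ** X"
      by (simp only: matrix_mul_assoc)
    finally have 2: "trace (P ** (B ** X ** transpose B)) = trace (mat 1 ** X)"
      by (simp only: B)
    show ?thesis
      using True 1 2 by (simp add: matrix_gamma_kernel_def posdef_congruence[OF B0] e_def)
  qed (simp add: matrix_gamma_kernel_def posdef_congruence[OF B0])
  \<comment> \<open>The Jacobian exponent cancels against that of the kernel:
    \<open>CARD('n) + 1 + 2 * e = 2 * \<alpha>\<close>.\<close>
  have "\<bar>det B\<bar> ^ (CARD('n) + 1) * \<bar>det B\<bar> powr (2 * e) = \<bar>det B\<bar> powr (2 * \<alpha>)"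
    using B0 by (simp add: powr_add[symmetric] powr_realpow[symmetric] e_def field_simps
        del: power_Suc)
  also have "\<dots> = ((det B)\<^sup>2) powr \<alpha>"
    using B0 by (simp add: powr_powr[symmetric])
  also have "(det B)\<^sup>2 = inverse (det P)"
    using detBP posdef_det_pos[OF P] by (simp add: field_simps)
  also have "inverse (det P) powr \<alpha> = det P powr - \<alpha>"
    by (simp add: powr_minus inverse_powr)
  finally have detB: "\<bar>det B\<bar> ^ (CARD('n) + 1) * \<bar>det B\<bar> powr (2 * e) = det P powr - \<alpha>" .
  have "(\<integral>\<^sup>+u. ennreal (matrix_gamma_kernel \<alpha> \<beta> P (sym_of u)) \<partial>PiM sym_index (\<lambda>_. lborel)) =
      ennreal (\<bar>det B\<bar> ^ (CARD('n) + 1)) * (\<integral>\<^sup>+u. ennreal (\<bar>det B\<bar> powr (2 * e)) *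
        ennreal (matrix_gamma_kernel \<alpha> \<beta> (mat 1 :: real^'n^'n) (sym_of u)) \<partial>PiM sym_index (\<lambda>_. lborel))"
    by (subst nn_integral_sym_of_congruence[OF B0])
       (simp_all add: kernel ennreal_mult matrix_gamma_kernel_nonneg)
  also have "\<dots> = ennreal (\<bar>det B\<bar> ^ (CARD('n) + 1)) * (ennreal (\<bar>det B\<bar> powr (2 * e)) * (\<integral>\<^sup>+u.
        ennreal (matrix_gamma_kernel \<alpha> \<beta> (mat 1 :: real^'n^'n) (sym_of u)) \<partial>PiM sym_index (\<lambda>_. lborel)))"
    by (subst nn_integral_cmult) simp_all
  also have "\<dots> = ennreal (\<bar>det B\<bar> ^ (CARD('n) + 1) * \<bar>det B\<bar> powr (2 * e)) * (\<integral>\<^sup>+u.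
        ennreal (matrix_gamma_kernel \<alpha> \<beta> (mat 1 :: real^'n^'n) (sym_of u)) \<partial>PiM sym_index (\<lambda>_. lborel))"
    by (simp add: ennreal_mult mult.assoc)
  finally show ?thesis
    unfolding detB .
qed

section \<open>Moment generating function and Chernoff bound\<close>

text \<open>The tilted density is a kernel with rate matrix \<open>Q\<close>. Its mass is compared
  with that for the inverse of \<Sigma>, where the product of the unknown constants \<open>C\<close>
  and \<open>K\<close> is fixed by total mass one.\<close>

lemma matrix_gamma_mgf:
  fixes \<Sigma> Q :: "real^'n^'n"
  assumes prob: "prob_space (matrix_gamma \<alpha> \<beta> \<Sigma>)" and \<Sigma>: "posdef \<Sigma>" and Q: "posdef Q"
  shows "(\<integral>\<^sup>+X. ennreal (exp (1 / \<beta> * trace ((matrix_inv \<Sigma> - Q) ** X))) \<partial>matrix_gamma \<alpha> \<beta> \<Sigma>) =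
         ennreal ((det Q * det \<Sigma>) powr - \<alpha>)"
proof -
  let ?P = "PiM (sym_index :: 'n set set) (\<lambda>_. lborel :: real measure)"
  define C where "C = det \<Sigma> powr (-\<alpha>) / (\<beta> powr (real CARD('n) * \<alpha>) * mgamma CARD('n) \<alpha>)"
  define K where "K = (\<integral>\<^sup>+u. ennreal (matrix_gamma_kernel \<alpha> \<beta> (mat 1 :: real^'n^'n) (sym_of u)) \<partial>?P)"
  have pdf: "ennreal (matrix_gamma_pdf \<alpha> \<beta> \<Sigma> X) =
      ennreal C * ennreal (matrix_gamma_kernel \<alpha> \<beta> (matrix_inv \<Sigma>) X)" for X
  proof -
    have "matrix_gamma_pdf \<alpha> \<beta> \<Sigma> X = C * matrix_gamma_kernel \<alpha> \<beta> (matrix_inv \<Sigma>) X"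
      by (simp add: matrix_gamma_pdf_def matrix_gamma_kernel_def C_def)
    then show ?thesis
      by (simp add: ennreal_mult'' matrix_gamma_kernel_nonneg)
  qed
  have integral: "(\<integral>\<^sup>+X. ennreal (exp (1 / \<beta> * trace ((matrix_inv \<Sigma> - R) ** X))) \<partial>matrix_gamma \<alpha> \<beta> \<Sigma>) =
      ennreal C * (ennreal (det R powr - \<alpha>) * K)" if R: "posdef R" for R
  proof -
    have [measurable]: "(\<lambda>X. trace ((matrix_inv \<Sigma> - R) ** X)) \<in> borel_measurable borel"
      by (intro borel_measurable_continuous_onI continuous_intros)
    have kernel: "matrix_gamma_kernel \<alpha> \<beta> (matrix_inv \<Sigma>) X * exp (1 / \<beta> * trace ((matrix_inv \<Sigma> - R) ** X)) =
        matrix_gamma_kernel \<alpha> \<beta> R X" for X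
    proof -
      have "trace ((matrix_inv \<Sigma> - R) ** X) = trace (matrix_inv \<Sigma> ** X) - trace (R ** X)"
        by (simp add: trace_def matrix_matrix_mult_def left_diff_distrib sum_subtractf)
      then show ?thesis
        by (simp add: matrix_gamma_kernel_def mult.assoc exp_add[symmetric] right_diff_distrib)
    qed
    have "(\<integral>\<^sup>+X. ennreal (exp (1 / \<beta> * trace ((matrix_inv \<Sigma> - R) ** X))) \<partial>matrix_gamma \<alpha> \<beta> \<Sigma>) =
        (\<integral>\<^sup>+u. ennreal C * ennreal (matrix_gamma_kernel \<alpha> \<beta> (matrix_inv \<Sigma>) (sym_of u)) *
           ennreal (exp (1 / \<beta> * trace ((matrix_inv \<Sigma> - R) ** sym_of u))) \<partial>?P)"
      unfolding matrix_gamma_def pdf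
      by (subst nn_integral_distr) (simp_all add: nn_integral_density)
    also have "\<dots> = (\<integral>\<^sup>+u. ennreal C * ennreal (matrix_gamma_kernel \<alpha> \<beta> R (sym_of u)) \<partial>?P)"
      by (simp only: mult.assoc ennreal_mult[OF matrix_gamma_kernel_nonneg exp_ge_zero, symmetric] kernel)
    also have "\<dots> = ennreal C * (ennreal (det R powr - \<alpha>) * K)"
      by (subst nn_integral_cmult) (simp_all add: nn_integral_matrix_gamma_kernel[OF R] K_def)
    finally show ?thesis .
  qed
  interpret prob_space "matrix_gamma \<alpha> \<beta> \<Sigma>"
    by (rule prob)
  \<comment> \<open>For \<open>R = matrix_inv \<Sigma>\<close> the exponent vanishes and the
    integral is the total mass.\<close>
  have "ennreal C * (ennreal (det (matrix_inv \<Sigma>) powr - \<alpha>) * K) = 1"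
    using integral[OF posdef_matrix_inv[OF \<Sigma>]]
    by (simp add: trace_def matrix_matrix_mult_def emeasure_space_1)
  moreover
  have "det Q powr - \<alpha> = (det Q * det \<Sigma>) powr - \<alpha> * det (matrix_inv \<Sigma>) powr - \<alpha>"
    using posdef_det_pos[OF Q] posdef_det_pos[OF \<Sigma>]
    by (simp add: det_matrix_inv_posdef[OF \<Sigma>] powr_mult[symmetric])
  then have "ennreal C * (ennreal (det Q powr - \<alpha>) * K) = ennreal ((det Q * det \<Sigma>) powr - \<alpha>) *
      (ennreal C * (ennreal (det (matrix_inv \<Sigma>) powr - \<alpha>) * K))"
    by (simp add: ennreal_mult mult_ac)
  ultimately show ?thesis
    unfolding integral[OF Q] by simp
qed

lemma linear_trace_mult: "linear (\<lambda>X. trace ((T :: real^'n^'n) ** X))"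
proof (rule linearI)
  show "trace (T ** (r *\<^sub>R X)) = r *\<^sub>R trace (T ** X)" for r X
    by (simp add: trace_def matrix_matrix_mult_def sum_distrib_left mult_ac)
qed (simp add: matrix_add_ldistrib trace_add)

text \<open>On \<open>E\<close> the product of the factors
  \<open>exp (1 / \<beta> * \<phi> (X l \<omega> - z))\<close> is at least 1, as the sum of their
  exponents is a nonnegative multiple of \<phi> at the centred mean. Independence factors the
  expectation of the product.\<close>

lemma (in prob_space) matrix_gamma_chernoff:
  fixes X :: "nat \<Rightarrow> 'a \<Rightarrow> real^'p^'p" and \<Sigma> Q z :: "real^'p^'p"
  assumes n: "n \<ge> 1" and \<beta>: "\<beta> > 0" and \<Sigma>: "posdef \<Sigma>" and Q: "posdef Q"
    and indep: "indep_vars (\<lambda>_. borel) X {1..n}"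
    and distr: "\<And>l. l \<in> {1..n} \<Longrightarrow> distr M borel (X l) = matrix_gamma \<alpha> \<beta> \<Sigma>"
    and E: "\<And>\<omega>. \<omega> \<in> E \<Longrightarrow>
      trace ((matrix_inv \<Sigma> - Q) ** ((1 / real n) *\<^sub>R (\<Sum>l\<in>{1..n}. X l \<omega>) - z)) \<ge> 0"
  shows "measure M E \<le>
    ((det Q * det \<Sigma>) powr - \<alpha> * exp (- (1 / \<beta>) * trace ((matrix_inv \<Sigma> - Q) ** z))) ^ n"
    (is "_ \<le> ?b ^ n")
\<comment> \<open>For a set that is not an event, \<open>measure\<close> takes the default value 0
  and the bound is trivial.\<close>
proof (cases "E \<in> events")
  case True
  define \<phi> where "\<phi> Y = trace ((matrix_inv \<Sigma> - Q) ** Y)" for Y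
  have lin: "linear \<phi>"
    unfolding \<phi>_def[abs_def] by (rule linear_trace_mult)
  have [measurable]: "\<phi> \<in> borel_measurable borel"
    unfolding \<phi>_def[abs_def] by (intro borel_measurable_continuous_onI continuous_intros)
  have X [measurable]: "X l \<in> borel_measurable M" if "l \<in> {1..n}" for l
    using indep that by (auto simp: indep_vars_def)
  \<comment> \<open>Normalisation of the matrix gamma law is inherited from the random variable
    \<open>X 1\<close>, which exists because \<open>n \<ge> 1\<close>.\<close>
  have "prob_space (distr M borel (X 1))"
    using n X by (intro prob_space_distr) auto
  then have prob: "prob_space (matrix_gamma \<alpha> \<beta> \<Sigma>)"
    using distr[of 1] n by simp
  have sum_\<phi>: "(\<Sum>l\<in>{1..n}. \<phi> (X l \<omega> - z)) =
      real n * \<phi> ((1 / real n) *\<^sub>R (\<Sum>l\<in>{1..n}. X l \<omega>) - z)" for \<omega>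
    using n by (simp add: linear_diff[OF lin] linear_sum[OF lin] linear_scale[OF lin]
        sum_subtractf right_diff_distrib)
  have single: "(\<integral>\<^sup>+\<omega>. ennreal (exp (1 / \<beta> * \<phi> (X l \<omega> - z))) \<partial>M) = ennreal ?b"
    if l: "l \<in> {1..n}" for l
  proof -
    note [measurable] = X[OF l]
    have "(\<integral>\<^sup>+\<omega>. ennreal (exp (1 / \<beta> * \<phi> (X l \<omega> - z))) \<partial>M) =
        (\<integral>\<^sup>+\<omega>. ennreal (exp (- (1 / \<beta>) * \<phi> z)) * ennreal (exp (1 / \<beta> * \<phi> (X l \<omega>))) \<partial>M)"
      by (simp add: linear_diff[OF lin] ennreal_mult[symmetric] exp_add[symmetric] right_diff_distrib
          diff_divide_distrib)
    also have "\<dots> = ennreal (exp (- (1 / \<beta>) * \<phi> z)) * (\<integral>\<^sup>+\<omega>. ennreal (exp (1 / \<beta> * \<phi> (X l \<omega>))) \<partial>M)"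
      by (rule nn_integral_cmult) measurable
    also have "(\<integral>\<^sup>+\<omega>. ennreal (exp (1 / \<beta> * \<phi> (X l \<omega>))) \<partial>M) =
        (\<integral>\<^sup>+Y. ennreal (exp (1 / \<beta> * \<phi> Y)) \<partial>distr M borel (X l))"
      by (simp add: nn_integral_distr)
    also have "\<dots> = ennreal ((det Q * det \<Sigma>) powr - \<alpha>)"
      unfolding distr[OF l] \<phi>_def by (rule matrix_gamma_mgf[OF prob \<Sigma> Q])
    finally show ?thesis
      by (simp add: \<phi>_def ennreal_mult[symmetric] mult.commute)
  qed
  have "emeasure M E = (\<integral>\<^sup>+\<omega>. indicator E \<omega> \<partial>M)"
    using True by simp
  also have "\<dots> \<le> (\<integral>\<^sup>+\<omega>. (\<Prod>l\<in>{1..n}. ennreal (exp (1 / \<beta> * \<phi> (X l \<omega> - z)))) \<partial>M)"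
  proof (rule nn_integral_mono)
    fix \<omega>
    have "(\<Prod>l\<in>{1..n}. ennreal (exp (1 / \<beta> * \<phi> (X l \<omega> - z)))) =
        ennreal (exp (1 / \<beta> * (\<Sum>l\<in>{1..n}. \<phi> (X l \<omega> - z))))"
      by (simp add: prod_ennreal exp_sum[symmetric] sum_distrib_left)
    moreover have "1 / \<beta> * (\<Sum>l\<in>{1..n}. \<phi> (X l \<omega> - z)) \<ge> 0" if "\<omega> \<in> E"
      unfolding sum_\<phi> using E[OF that] \<beta> by (simp add: \<phi>_def)
    ultimately show "indicator E \<omega> \<le> (\<Prod>l\<in>{1..n}. ennreal (exp (1 / \<beta> * \<phi> (X l \<omega> - z))))"
      by (auto simp: indicator_def)
  qed
  also have "\<dots> = (\<Prod>l\<in>{1..n}. \<integral>\<^sup>+\<omega>. ennreal (exp (1 / \<beta> * \<phi> (X l \<omega> - z))) \<partial>M)"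
    by (intro indep_vars_nn_integral indep_vars_compose2[OF indep]) auto
  also have "\<dots> = ennreal ?b ^ n"
    using single by simp
  finally show ?thesis
    by (simp add: emeasure_eq_measure ennreal_power)
qed (simp add: measure_notin_sets)

section \<open>The bounds for the sample mean\<close>

lemma det_scaleR: "det (c *\<^sub>R (A :: real^'n^'n)) = c ^ CARD('n) * det A"
proof -
  have "c *\<^sub>R A = mat c ** A"
    by (simp add: vec_eq_iff matrix_matrix_mult_def mat_def if_distrib[of "\<lambda>x. x * _"] cong: if_cong)
  moreover have "det (mat c :: real^'n^'n) = c ^ CARD('n)"
    using det_matrix_scaleR[of c, where 'n = 'n] by (simp add: matrix_scaleR)
  ultimately show ?thesis
    by (simp add: det_mul)
qed

theorem theorem13:
  fixes M :: "'a measure" and X :: "nat \<Rightarrow> 'a \<Rightarrow> real^'p^'p"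
    and n :: nat and \<alpha> \<beta> :: real and \<Sigma> :: "real^'p^'p"
  assumes "prob_space M"
    and "n \<ge> 1"
    and "\<beta> > 0"
    and "\<alpha> > (real CARD('p) - 1) / 2"
    and "posdef \<Sigma>"
    and "prob_space.indep_vars M (\<lambda>_. borel) X {1..n}"
    and "\<And>l. l \<in> {1..n} \<Longrightarrow> distr M borel (X l) = matrix_gamma \<alpha> \<beta> \<Sigma>"
  defines "Xbar \<equiv> \<lambda>\<omega>. (1 / real n) *\<^sub>R (\<Sum>l\<in>{1..n}. X l \<omega>)"
    and "\<mu> \<equiv> (\<alpha> * \<beta>) *\<^sub>R \<Sigma>"
    and "B \<equiv> \<lambda>z. ((exp 1 / (\<alpha> * \<beta>)) powr (real CARD('p) * \<alpha>)
                  * (det z / det \<Sigma>) powr \<alpha>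
                  * exp (- (1 / \<beta>) * trace (matrix_inv \<Sigma> ** z))) ^ n"
  shows "(\<forall>z. posdef z \<and> \<mu> \<prec>\<^sub>L z \<longrightarrow>
            measure M {\<omega> \<in> space M. z \<prec>\<^sub>L Xbar \<omega>} \<le> B z)
       \<and> (\<forall>z. posdef z \<and> z \<prec>\<^sub>L \<mu> \<longrightarrow>
            measure M {\<omega> \<in> space M. Xbar \<omega> \<prec>\<^sub>L z} \<le> B z)
       \<and> (\<forall>\<rho>::real. \<rho> \<ge> 1 \<longrightarrow>
            measure M {\<omega> \<in> space M. (\<rho> *\<^sub>R \<mu>) \<prec>\<^sub>L Xbar \<omega>}
              \<le> (\<rho> * exp (1 - \<rho>)) powr (real n * real CARD('p) * \<alpha>))
       \<and> (\<forall>\<rho>::real. 0 \<le> \<rho> \<and> \<rho> \<le> 1 \<longrightarrow>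
            measure M {\<omega> \<in> space M. Xbar \<omega> \<prec>\<^sub>L (\<rho> *\<^sub>R \<mu>)}
              \<le> (\<rho> * exp (1 - \<rho>)) powr (real n * real CARD('p) * \<alpha>))"
proof -
  interpret prob_space M by fact
  note n = \<open>n \<ge> 1\<close> and \<beta> = \<open>\<beta> > 0\<close> and \<Sigma> = \<open>posdef \<Sigma>\<close> and indep = assms(6) and distr = assms(7)
  let ?p = "real CARD('p)"
  have "real CARD('p) \<ge> 1"
    by (simp add: Suc_le_eq)
  then have "(?p - 1) / 2 \<ge> 0"
    by simp
  then have \<alpha>: "\<alpha> > 0"
    using assms(4) by (rule order_le_less_trans)
  have \<mu>: "posdef \<mu>"
    using posdef_scaleR[OF \<Sigma>] \<alpha> \<beta> by (simp add: \<mu>_def)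
  have \<mu>_inv: "matrix_inv \<Sigma> = (\<alpha> * \<beta>) *\<^sub>R matrix_inv \<mu>"
  proof -
    have "\<Sigma> ** ((\<alpha> * \<beta>) *\<^sub>R matrix_inv \<mu>) = \<mu> ** matrix_inv \<mu>"
      by (simp add: \<mu>_def matrix_scalar_ac scalar_matrix_assoc)
    then have "\<Sigma> ** ((\<alpha> * \<beta>) *\<^sub>R matrix_inv \<mu>) = mat 1"
      by (simp add: posdef_matrix_inv_mult[OF \<mu>])
    then show ?thesis
      by (metis \<Sigma> matrix_mul_assoc matrix_mul_lid matrix_mul_rid posdef_matrix_inv_mult(2))
  qed
  have chernoff: "measure M E \<le> B z"
    if z: "posdef z"
      and E: "\<And>\<omega>. \<omega> \<in> E \<Longrightarrow> trace ((matrix_inv \<mu> - matrix_inv z) ** (Xbar \<omega> - z)) \<ge> 0" for z E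
  proof -
    \<comment> \<open>This is the stationary point of
      \<open>- \<alpha> * ln (det Q) + trace (Q ** z) / \<beta>\<close>, the part of the logarithm
      of the bound that depends on \<open>Q\<close>. It makes \<open>trace (Q ** z)\<close> equal to
      \<open>\<alpha> * \<beta> * CARD('p)\<close>, the source of the power of
      \<open>exp 1\<close>.\<close>
    define Q where "Q = (\<alpha> * \<beta>) *\<^sub>R matrix_inv z"
    have Q: "posdef Q"
      unfolding Q_def using \<alpha> \<beta> by (intro posdef_scaleR posdef_matrix_inv z) simp
    have diff: "matrix_inv \<Sigma> - Q = (\<alpha> * \<beta>) *\<^sub>R (matrix_inv \<mu> - matrix_inv z)"
      by (simp add: \<mu>_inv Q_def scaleR_right_diff_distrib)
    have "trace ((matrix_inv \<Sigma> - Q) ** Y) = \<alpha> * \<beta> * trace ((matrix_inv \<mu> - matrix_inv z) ** Y)" for Y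
      unfolding diff by (simp add: trace_def matrix_matrix_mult_def sum_distrib_left mult_ac)
    then have "measure M E \<le>
        ((det Q * det \<Sigma>) powr - \<alpha> * exp (- (1 / \<beta>) * trace ((matrix_inv \<Sigma> - Q) ** z))) ^ n"
      using E \<alpha> \<beta> unfolding Xbar_def
      by (intro matrix_gamma_chernoff[OF n \<beta> \<Sigma> Q indep distr]) auto
    also have "(det Q * det \<Sigma>) powr - \<alpha> * exp (- (1 / \<beta>) * trace ((matrix_inv \<Sigma> - Q) ** z)) =
        (exp 1 / (\<alpha> * \<beta>)) powr (?p * \<alpha>) * (det z / det \<Sigma>) powr \<alpha>
          * exp (- (1 / \<beta>) * trace (matrix_inv \<Sigma> ** z))"
    proof -
      have "(matrix_inv \<Sigma> - Q) ** z = matrix_inv \<Sigma> ** z - (\<alpha> * \<beta>) *\<^sub>R (matrix_inv z ** z)"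
        by (simp add: Q_def vec_eq_iff matrix_matrix_mult_def left_diff_distrib right_diff_distrib
            sum_subtractf sum_distrib_left mult_ac)
      then have tr: "trace ((matrix_inv \<Sigma> - Q) ** z) = trace (matrix_inv \<Sigma> ** z) - \<alpha> * \<beta> * ?p"
        by (simp add: posdef_matrix_inv_mult[OF z] trace_def sum_subtractf mat_def)
      have det: "det Q * det \<Sigma> = (\<alpha> * \<beta>) ^ CARD('p) * det \<Sigma> / det z"
        by (simp add: Q_def det_scaleR det_matrix_inv_posdef[OF z])
      show ?thesis
        unfolding tr det
        using \<alpha> \<beta> posdef_det_pos[OF z] posdef_det_pos[OF \<Sigma>]
        by (simp add: powr_def ln_mult ln_div ln_realpow exp_add[symmetric] field_simps)
    qed
    finally show ?thesis
      unfolding B_def .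
  qed
  \<comment> \<open>In the lower tail both factors are negative; reversing both differences leaves
    the trace unchanged and makes them nonnegative.\<close>
  have trace_flip: "trace ((P - R) ** (Y - z)) = trace ((R - P) ** (z - Y))" for P R Y z :: "real^'p^'p"
    by (simp add: trace_def matrix_matrix_mult_def algebra_simps)
  have upper: "measure M {\<omega> \<in> space M. z \<prec>\<^sub>L Xbar \<omega>} \<le> B z" if "posdef z" "\<mu> \<prec>\<^sub>L z" for z
  proof (rule chernoff[OF that(1)])
    fix \<omega> assume "\<omega> \<in> {\<omega> \<in> space M. z \<prec>\<^sub>L Xbar \<omega>}"
    then show "trace ((matrix_inv \<mu> - matrix_inv z) ** (Xbar \<omega> - z)) \<ge> 0"
      using loewner_less_matrix_inv_antimono[OF \<mu> that]
      by (intro trace_mult_posdef_nonneg) (auto simp: loewner_less_def)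
  qed
  have lower: "measure M {\<omega> \<in> space M. Xbar \<omega> \<prec>\<^sub>L z} \<le> B z" if "posdef z" "z \<prec>\<^sub>L \<mu>" for z
  proof (rule chernoff[OF that(1)])
    fix \<omega> assume "\<omega> \<in> {\<omega> \<in> space M. Xbar \<omega> \<prec>\<^sub>L z}"
    then show "trace ((matrix_inv \<mu> - matrix_inv z) ** (Xbar \<omega> - z)) \<ge> 0"
      unfolding trace_flip[of "matrix_inv \<mu>"]
      using loewner_less_matrix_inv_antimono[OF that(1) \<mu> that(2)]
      by (intro trace_mult_posdef_nonneg) (auto simp: loewner_less_def)
  qed
  have B_scaled: "B (\<rho> *\<^sub>R \<mu>) = (\<rho> * exp (1 - \<rho>)) powr (real n * ?p * \<alpha>)" if "\<rho> > 0" for \<rho>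
  proof -
    have "matrix_inv \<Sigma> ** (\<rho> *\<^sub>R \<mu>) = (\<rho> * (\<alpha> * \<beta>)) *\<^sub>R (matrix_inv \<Sigma> ** \<Sigma>)"
      by (simp add: \<mu>_def vec_eq_iff matrix_matrix_mult_def sum_distrib_left mult_ac)
    then have tr: "trace (matrix_inv \<Sigma> ** (\<rho> *\<^sub>R \<mu>)) = \<rho> * \<alpha> * \<beta> * ?p"
      by (simp add: posdef_matrix_inv_mult[OF \<Sigma>] trace_def mat_def)
    have det: "det (\<rho> *\<^sub>R \<mu>) / det \<Sigma> = (\<rho> * (\<alpha> * \<beta>)) ^ CARD('p)"
      using posdef_det_pos[OF \<Sigma>] by (simp add: \<mu>_def det_scaleR power_mult_distrib)
    have "(exp 1 / (\<alpha> * \<beta>)) powr (?p * \<alpha>) * (det (\<rho> *\<^sub>R \<mu>) / det \<Sigma>) powr \<alpha>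
          * exp (- (1 / \<beta>) * trace (matrix_inv \<Sigma> ** (\<rho> *\<^sub>R \<mu>))) = exp (?p * \<alpha> * (ln \<rho> + 1 - \<rho>))"
      unfolding tr det using \<alpha> \<beta> that
      by (simp add: powr_def ln_mult ln_div ln_realpow exp_add[symmetric] algebra_simps)
    then have "B (\<rho> *\<^sub>R \<mu>) = exp (real n * (?p * \<alpha> * (ln \<rho> + 1 - \<rho>)))"
      unfolding B_def by (simp add: exp_of_nat_mult)
    also have "\<dots> = (\<rho> * exp (1 - \<rho>)) powr (real n * ?p * \<alpha>)"
      using that by (simp add: powr_def ln_mult algebra_simps)
    finally show ?thesis .
  qed
  have upper_scaled: "measure M {\<omega> \<in> space M. (\<rho> *\<^sub>R \<mu>) \<prec>\<^sub>L Xbar \<omega>}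
      \<le> (\<rho> * exp (1 - \<rho>)) powr (real n * ?p * \<alpha>)" if "\<rho> \<ge> 1" for \<rho>
  \<comment> \<open>At \<open>\<rho> = 1\<close> the strict order between the threshold and \<mu>
    fails, but the claimed bound is 1.\<close>
  proof (cases "\<rho> = 1")
    case False
    then have "\<rho> > 1"
      using that by simp
    moreover have "\<rho> *\<^sub>R \<mu> - \<mu> = (\<rho> - 1) *\<^sub>R \<mu>"
      by (simp add: scaleR_left_diff_distrib)
    ultimately show ?thesis
      using upper[of "\<rho> *\<^sub>R \<mu>"] B_scaled[of \<rho>] posdef_scaleR[OF \<mu>] by (simp add: loewner_less_def)
  qed simp
  have lower_scaled: "measure M {\<omega> \<in> space M. Xbar \<omega> \<prec>\<^sub>L (\<rho> *\<^sub>R \<mu>)}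
      \<le> (\<rho> * exp (1 - \<rho>)) powr (real n * ?p * \<alpha>)" if "0 < \<rho>" "\<rho> \<le> 1" for \<rho>
  proof (cases "\<rho> = 1")
    case False
    moreover have "\<mu> - \<rho> *\<^sub>R \<mu> = (1 - \<rho>) *\<^sub>R \<mu>"
      by (simp add: scaleR_left_diff_distrib)
    ultimately show ?thesis
      using that lower[of "\<rho> *\<^sub>R \<mu>"] B_scaled[of \<rho>] posdef_scaleR[OF \<mu>] by (simp add: loewner_less_def)
  qed simp
  have Xbar [measurable]: "Xbar \<in> borel_measurable M"
    unfolding Xbar_def using indep
    by (intro borel_measurable_scaleR borel_measurable_const borel_measurable_sum)
       (auto simp: indep_vars_def)
  \<comment> \<open>The zero matrix is not positive definite, so \<open>lower\<close> does not
    apply. The event is contained in the one for every small positive \<rho>, whose bound tends to 0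
    because the exponent is positive.\<close>
  have lower_zero: "measure M {\<omega> \<in> space M. Xbar \<omega> \<prec>\<^sub>L (0 *\<^sub>R \<mu>)} \<le> 0"
  proof (rule tendsto_lowerbound)
    let ?c = "real n * ?p * \<alpha>"
    have "((\<lambda>\<rho>. (\<rho> * exp (1 - \<rho>)) powr ?c) \<longlongrightarrow> (0 * exp (1 - 0)) powr ?c) (at_right 0)"
      using n \<alpha>
      by (intro tendsto_powr' tendsto_intros)
         (auto simp: eventually_at_filter)
    then show "((\<lambda>\<rho>. (\<rho> * exp (1 - \<rho>)) powr ?c) \<longlongrightarrow> 0) (at_right 0)"
      by simp
    have "measure M {\<omega> \<in> space M. Xbar \<omega> \<prec>\<^sub>L (0 *\<^sub>R \<mu>)} \<le> (\<rho> * exp (1 - \<rho>)) powr ?c"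
      if "0 < \<rho>" "\<rho> < 1" for \<rho>
    proof -
      have "{\<omega> \<in> space M. Xbar \<omega> \<prec>\<^sub>L (0 *\<^sub>R \<mu>)} \<subseteq> {\<omega> \<in> space M. Xbar \<omega> \<prec>\<^sub>L (\<rho> *\<^sub>R \<mu>)}"
        using posdef_add[OF posdef_scaleR[OF \<mu> that(1)]] by (force simp: loewner_less_def)
      then have "measure M {\<omega> \<in> space M. Xbar \<omega> \<prec>\<^sub>L (0 *\<^sub>R \<mu>)} \<le>
          measure M {\<omega> \<in> space M. Xbar \<omega> \<prec>\<^sub>L (\<rho> *\<^sub>R \<mu>)}"
        \<comment> \<open>Monotonicity needs the larger set to be an event, which follows from
          measurability of \<open>Xbar\<close> and of \<open>posdef\<close>.\<close>
        by (rule finite_measure_mono) (simp add: loewner_less_def)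
      with lower_scaled[of \<rho>] that show ?thesis
        by simp
    qed
    then show "\<forall>\<^sub>F \<rho> in at_right 0. measure M {\<omega> \<in> space M. Xbar \<omega> \<prec>\<^sub>L (0 *\<^sub>R \<mu>)} \<le>
        (\<rho> * exp (1 - \<rho>)) powr ?c"
      using eventually_at_right_less[of "0::real"] eventually_at_right_real[of 0 "1::real"]
      by (auto elim: eventually_mono)
  qed simp
  show ?thesis
  proof (intro conjI allI impI)
    fix \<rho> :: real assume "0 \<le> \<rho> \<and> \<rho> \<le> 1"
    then show "measure M {\<omega> \<in> space M. Xbar \<omega> \<prec>\<^sub>L (\<rho> *\<^sub>R \<mu>)}
        \<le> (\<rho> * exp (1 - \<rho>)) powr (real n * ?p * \<alpha>)"
      using lower_scaled[of \<rho>] lower_zero by (cases "\<rho> = 0") auto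
  qed (use upper lower upper_scaled in auto)
qed

end
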